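(* Let $G=(V,E)$ be a finite graph with $V=I\cup B$ (disjoint union of interior and boundary vertices), let $f=(f_b)_{b\in B}\in\{-1,+1\}^B$ be a boundary condition, let $\beta>0$, and let $p_{\mathrm{V}}$ be the Ising distribution on $\{-1,+1\}^I$ with boundary condition $f$, $$p_{\mathrm{V}}(s)\propto \exp\Big(\beta\sum_{ij\in E}s_is_j+\beta\sum_{ib\in E}s_if_b\Big).$$ Suppose there is a map $m:V\to V$ such that: (i) $m(I)\subseteq I$, $m(B)\subseteq B$ and $m^2=\mathrm{id}$; (ii) for $i,j\in I$, $ij\in E$ if and only if $m(i)m(j)\in E$, and for $i\in I$, $b\in B$, $ib\in E$ if and only if $m(i)m(b)\in E$; (iii) $f_{m(b)}=-f_b$ for all $b\in B$. Let $P_{\mathrm{DF}}$ be the transition matrix of the double flip move, i.e. $P_{\mathrm{DF}}(s,t)=1$ if $t_{m(i)}=-s_i$ for all $i\in I$, and $P_{\mathrm{DF}}(s,t)=0$ otherwise. Then the double flip move satisfies detailed balance with respect to $p_{\mathrm{V}}$: for all $s,t\in\{-1,+1\}^I$, $$p_{\mathrm{V}}(s)\,P_{\mathrm{DF}}(s,t)=p_{\mathrm{V}}(t)\,P_{\mathrm{DF}}(t,s).$$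
   Context: The graph is simple and undirected. Every edge is either an interior edge $ij$ with $i,j\in I$, or an edge $ib$ joining an interior vertex $i\in I$ to a boundary vertex $b\in B$; the letters $i,j$ always denote vertices of $I$ and $b$ a vertex of $B$. Thus $\sum_{ij\in E}$ is the sum over interior edges (each unordered edge counted once) and $\sum_{ib\in E}$ the sum over interior-boundary edges. A spin configuration is $s=(s_i)_{i\in I}\in\{-1,+1\}^I$, and $\propto$ means equality up to the normalization constant making $p_{\mathrm{V}}$ a probability distribution on $\{-1,+1\}^I$. The double flip move deterministically sends the current configuration $s$ to the configuration $t$ defined by $t_{m(i)}=-s_i$ for all $i\in I$ (equivalently $t_i=-s_{m(i)}$). *)

theory Defs
  imports Complex_Main "HOL-Library.FuncSet"
begin

(* A finite graph with interior vertices I and boundary vertices B is given by its set E of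
   edges, each edge being the two-element set of its endpoints. *)

definition interior_edges :: "'v set \<Rightarrow> 'v set set \<Rightarrow> 'v set set" where
  "interior_edges I E = {e \<in> E. e \<subseteq> I}"

definition boundary_edges :: "'v set \<Rightarrow> 'v set \<Rightarrow> 'v set set \<Rightarrow> ('v \<times> 'v) set" where
  "boundary_edges I B E = {(i, b). i \<in> I \<and> b \<in> B \<and> {i, b} \<in> E}"

(* Extensional functions, so that every element of {-1,+1}^I has exactly one representative
   and the partition function below is a finite sum. *)
definition spin_configs :: "'v set \<Rightarrow> ('v \<Rightarrow> real) set" where
  "spin_configs I = (I \<rightarrow>\<^sub>E {-1, 1})"

(* For an interior edge e = {i, j} with i and j distinct, the product over e is s i * s j;
   summing over the sets e counts each unordered edge once. *)
definition ising_weight ::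
  "'v set \<Rightarrow> 'v set \<Rightarrow> 'v set set \<Rightarrow> ('v \<Rightarrow> real) \<Rightarrow> real \<Rightarrow> ('v \<Rightarrow> real) \<Rightarrow> real" where
  "ising_weight I B E f \<beta> s =
     exp (\<beta> * (\<Sum>e\<in>interior_edges I E. \<Prod>i\<in>e. s i)
        + \<beta> * (\<Sum>(i, b)\<in>boundary_edges I B E. s i * f b))"

definition ising_prob ::
  "'v set \<Rightarrow> 'v set \<Rightarrow> 'v set set \<Rightarrow> ('v \<Rightarrow> real) \<Rightarrow> real \<Rightarrow> ('v \<Rightarrow> real) \<Rightarrow> real" where
  "ising_prob I B E f \<beta> s =
     ising_weight I B E f \<beta> s / (\<Sum>u\<in>spin_configs I. ising_weight I B E f \<beta> u)"

definition double_flip :: "'v set \<Rightarrow> ('v \<Rightarrow> 'v) \<Rightarrow> ('v \<Rightarrow> real) \<Rightarrow> ('v \<Rightarrow> real) \<Rightarrow> real" where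
  "double_flip I m s t = (if \<forall>i\<in>I. t (m i) = - s i then 1 else 0)"

lemma sum_ising_prob:
  assumes "finite I"
  shows "(\<Sum>s\<in>spin_configs I. ising_prob I B E f \<beta> s) = 1"
proof -
  have "finite (spin_configs I)" and "spin_configs I \<noteq> {}"
    using assms by (auto simp: spin_configs_def PiE_eq_empty_iff intro!: finite_PiE)
  then have "(\<Sum>u\<in>spin_configs I. ising_weight I B E f \<beta> u) > 0"
    by (intro sum_pos) (auto simp: ising_weight_def)
  then show ?thesis
    by (simp add: ising_prob_def flip: sum_divide_distrib)
qed

end

theory Submission
  imports Defs
begin

text \<open>
  The double flip is an involution, so its transition matrix is symmetric. It preserves the
  Ising weight: reindexing the edges by \<open>m\<close>, the two signs of an interior edge cancel each
  other, and the sign of a boundary edge cancels against \<open>f (m b) = - f b\<close>.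
\<close>

lemma double_flip_sym:
  assumes "m ` I \<subseteq> I" and "\<forall>i\<in>I. m (m i) = i"
  shows "double_flip I m s t = double_flip I m t s"
proof -
  \<comment> \<open>Stated for arbitrary \<open>u\<close> and \<open>v\<close>, so that swapping
    \<open>s\<close> and \<open>t\<close> yields both directions of the equivalence. The hypothesis
    is evaluated at \<open>m i\<close>, where the involution turns \<open>m (m i)\<close> back into
    \<open>i\<close>.\<close>
  have *: "\<forall>i\<in>I. v (m i) = - u i" if "\<forall>i\<in>I. u (m i) = - v i" for u v :: "'a \<Rightarrow> real"
  proof
    fix i assume "i \<in> I"
    then have "u (m (m i)) = - v (m i)" using assms(1) that by blast
    then show "v (m i) = - u i" using assms(2) \<open>i \<in> I\<close> by simp
  qed
  have "(\<forall>i\<in>I. t (m i) = - s i) \<longleftrightarrow> (\<forall>i\<in>I. s (m i) = - t i)"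
    by (rule iffI[OF *[of t s] *[of s t]])
  then show ?thesis unfolding double_flip_def by (rule if_cong) (rule refl)+
qed

text \<open>The hypothesis \<open>edge\<close> matters for the signs: a product over two distinct
  endpoints picks up two minus signs, whereas over a singleton one would survive.\<close>

lemma interior_sum_double_flip:
  fixes s t :: "'v \<Rightarrow> real"
  assumes edge: "\<And>e. e \<in> interior_edges I E \<Longrightarrow> \<exists>i\<in>I. \<exists>j\<in>I. i \<noteq> j \<and> e = {i, j}"
    and mI: "m ` I \<subseteq> I" and inv: "\<forall>i\<in>I. m (m i) = i"
    and mE: "\<forall>i\<in>I. \<forall>j\<in>I. {i, j} \<in> E \<longleftrightarrow> {m i, m j} \<in> E"
    and flip: "\<forall>i\<in>I. t (m i) = - s i"
  shows "(\<Sum>e\<in>interior_edges I E. \<Prod>i\<in>e. s i) = (\<Sum>e\<in>interior_edges I E. \<Prod>i\<in>e. t i)"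
proof -
  have *: "m ` e \<in> interior_edges I E \<and> m ` m ` e = e \<and> (\<Prod>i\<in>m ` e. t i) = (\<Prod>i\<in>e. s i)"
    if e: "e \<in> interior_edges I E" for e
  proof -
    from edge[OF e] obtain i j where ij: "i \<in> I" "j \<in> I" "i \<noteq> j" "e = {i, j}" by blast
    \<comment> \<open>Without distinct images the set \<open>{m i, m j}\<close> would collapse and
      the product over it would lose a factor.\<close>
    have "m i \<noteq> m j" using ij inv by metis
    moreover have "m i \<in> I" "m j \<in> I" using ij mI by blast+
    moreover have "{m i, m j} \<in> E" using e ij mE unfolding interior_edges_def by blast
    ultimately show ?thesis using ij inv flip by (simp add: interior_edges_def)
  qed
  show ?thesis
    \<comment> \<open>On interior edges \<open>image m\<close> is its own inverse, so it serves as
      both maps of the bijection.\<close>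
    by (rule sum.reindex_bij_witness[where i = "image m" and j = "image m"]) (simp_all add: *)
qed

text \<open>Since \<open>m\<close> respects the splitting into \<open>I\<close> and
  \<open>B\<close>, \<open>map_prod m m\<close> is an involution on the edge pairs, and
  \<open>t (m i) * f (m b) = (- s i) * (- f b)\<close>.\<close>

lemma boundary_sum_double_flip:
  assumes mI: "m ` I \<subseteq> I" and mB: "m ` B \<subseteq> B" and inv: "\<forall>v\<in>I \<union> B. m (m v) = v"
    and mE: "\<forall>i\<in>I. \<forall>b\<in>B. {i, b} \<in> E \<longleftrightarrow> {m i, m b} \<in> E"
    and mf: "\<forall>b\<in>B. f (m b) = - f b"
    and flip: "\<forall>i\<in>I. t (m i) = - s i"
  shows "(\<Sum>(i, b)\<in>boundary_edges I B E. s i * f b) =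
    (\<Sum>(i, b)\<in>boundary_edges I B E. t i * (f b :: real))"
proof -
  have *: "map_prod m m x \<in> boundary_edges I B E \<and> map_prod m m (map_prod m m x) = x
      \<and> (case map_prod m m x of (i, b) \<Rightarrow> t i * f b) = (case x of (i, b) \<Rightarrow> s i * f b)"
    if x: "x \<in> boundary_edges I B E" for x
  proof -
    obtain i b where ib: "x = (i, b)" "i \<in> I" "b \<in> B" "{i, b} \<in> E"
      using x by (auto simp: boundary_edges_def)
    have "m i \<in> I" "m b \<in> B" "{m i, m b} \<in> E" using ib mI mB mE by blast+
    then show ?thesis using ib inv mf flip by (simp add: boundary_edges_def)
  qed
  show ?thesis
    by (rule sum.reindex_bij_witness[where i = "map_prod m m" and j = "map_prod m m"])
      (simp_all add: *)
qed

theorem theorem1: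
  fixes V I B :: "'v set" and E :: "'v set set"
    and f :: "'v \<Rightarrow> real" and \<beta> :: real and m :: "'v \<Rightarrow> 'v"
  assumes "finite V" and "V = I \<union> B" and "I \<inter> B = {}"
    and "E \<subseteq> {{i, j} | i j. i \<in> I \<and> j \<in> I \<and> i \<noteq> j} \<union> {{i, b} | i b. i \<in> I \<and> b \<in> B}"
    and "f \<in> B \<rightarrow> {-1, 1}"
    and "\<beta> > 0"
    and "m \<in> V \<rightarrow> V"
    and "m ` I \<subseteq> I" and "m ` B \<subseteq> B" and "\<forall>v\<in>V. m (m v) = v"
    and "\<forall>i\<in>I. \<forall>j\<in>I. {i, j} \<in> E \<longleftrightarrow> {m i, m j} \<in> E"
    and "\<forall>i\<in>I. \<forall>b\<in>B. {i, b} \<in> E \<longleftrightarrow> {m i, m b} \<in> E"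
    and "\<forall>b\<in>B. f (m b) = - f b"
  shows "\<forall>s\<in>spin_configs I. \<forall>t\<in>spin_configs I.
           ising_prob I B E f \<beta> s * double_flip I m s t
         = ising_prob I B E f \<beta> t * double_flip I m t s"
proof (intro ballI)
  fix s t
  have inv: "\<forall>i\<in>I. m (m i) = i" using assms(2,10) by blast
  have edge: "\<exists>i\<in>I. \<exists>j\<in>I. i \<noteq> j \<and> e = {i, j}" if e: "e \<in> interior_edges I E" for e
  proof -
    have "e \<in> E" "e \<subseteq> I" using e by (auto simp: interior_edges_def)
    \<comment> \<open>An edge with an endpoint in \<open>B\<close> cannot lie inside
      \<open>I\<close>, by disjointness, which leaves only pairs of distinct interior
      vertices.\<close>
    then show ?thesis using assms(3,4) by blast
  qed
  have "ising_prob I B E f \<beta> s = ising_prob I B E f \<beta> t" if "\<forall>i\<in>I. t (m i) = - s i"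
    using interior_sum_double_flip[OF edge assms(8) inv assms(11) that]
      boundary_sum_double_flip[OF assms(8,9) assms(10)[unfolded assms(2)] assms(12,13) that]
    by (simp add: ising_prob_def ising_weight_def)
  then show "ising_prob I B E f \<beta> s * double_flip I m s t
      = ising_prob I B E f \<beta> t * double_flip I m t s"
    \<comment> \<open>Both sides now carry the same matrix entry; it vanishes unless
      \<open>t\<close> is the flip of \<open>s\<close>, the case where the probabilities
      agree.\<close>
    unfolding double_flip_sym[OF assms(8) inv, of t s] by (simp add: double_flip_def)
qed

end
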